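(* For every language $L\in\mathrm{S}^{=}_{rat}$ there exists a number $n$ such that for every error bound $\epsilon>0$ there exist $n$-state one-way quantum finite automata with restart that recognize $L$ and $\overline{L}$, respectively, with one-sided error bounded by $\epsilon$.
   Context: Let $\vdash,\dashv\notin\Sigma$ be end-markers, $\Gamma=\Sigma\cup\{\vdash,\dashv\}$. A one-way probabilistic finite automaton (1PFA) has a finite state set, an initial state, a set of accepting states, and for each $\sigma\in\Gamma$ a stochastic transition matrix; on input $w$ it reads $\vdash w\dashv$ left to right, and accepts with the probability of ending in an accepting state. It is rational if all entries of its transition matrices are rational. $\mathrm{S}^{=}_{rat}$ is the class of languages $L$ for which there is a rational 1PFA accepting a string $w$ with probability exactly $\frac12$ if and only if $w\in L$. A one-way quantum finite automaton with restart over $\Sigma$ has a finite state set $Q$ partitioned into $Q_{non}$, $Q_{acc}$, $Q_{rej}$, $Q_{restart}$, an initial state $q_0\in Q_{non}$, and unitary operators $U_\sigma$ ($\sigma\in\Gamma$) on the space with basis $\{|q\rangle:q\in Q\}$; in each round it starts in $|q_0\rangle$ on $\vdash$ and reads $\vdash w\dashv$ left to right, on each symbol applying $U_\sigma$ and then measuring projectively onto the spans of $Q_{acc},Q_{rej},Q_{non},Q_{restart}$; accept/reject halts with that answer, nonhalting continues with the normalized projection onto the span of $Q_{non}$, restart starts a new round; each round ends by halting or restarting with probability 1; the acceptance/rejection probability is that of eventually accepting/rejecting. A machine recognizes a language $K$ with one-sided error bounded by $\epsilon$ if either it accepts all members of $K$ with probability 1 and rejects all nonmembers with probability at least $1-\epsilon$,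 or it rejects all nonmembers with probability 1 and accepts all members with probability at least $1-\epsilon$. *)

theory Defs
  imports Complex_Main "Jordan_Normal_Form.Schur_Decomposition"
begin

datatype 'a tape_symbol = Left_End | Letter 'a | Right_End

definition tape :: "'a list \<Rightarrow> 'a tape_symbol list" where
  "tape w = Left_End # map Letter w @ [Right_End]"


(* The states of a machine with n states are 0, ..., n-1.  Matrices act on column vectors
   from the left, so entry (i, j) of a transition matrix belongs to the move from j to i. *)

record 'a pfa =
  pfa_size :: nat
  pfa_init :: nat
  pfa_accepting :: "nat set"
  pfa_trans :: "'a tape_symbol \<Rightarrow> real mat"

definition stochastic_mat :: "nat \<Rightarrow> real mat \<Rightarrow> bool" where
  "stochastic_mat n A \<longleftrightarrow>
     A \<in> carrier_mat n n \<and>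
     (\<forall>i<n. \<forall>j<n. A $$ (i, j) \<ge> 0) \<and>
     (\<forall>j<n. (\<Sum>i<n. A $$ (i, j)) = 1)"

definition is_pfa :: "'a pfa \<Rightarrow> bool" where
  "is_pfa P \<longleftrightarrow>
     pfa_init P < pfa_size P \<and>
     pfa_accepting P \<subseteq> {..<pfa_size P} \<and>
     (\<forall>\<sigma>. stochastic_mat (pfa_size P) (pfa_trans P \<sigma>))"

definition rational_pfa :: "'a pfa \<Rightarrow> bool" where
  "rational_pfa P \<longleftrightarrow>
     (\<forall>\<sigma>. \<forall>i<pfa_size P. \<forall>j<pfa_size P. pfa_trans P \<sigma> $$ (i, j) \<in> \<rat>)"

definition pfa_final_vec :: "'a pfa \<Rightarrow> 'a list \<Rightarrow> real vec" where
  "pfa_final_vec P w =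
     fold (\<lambda>\<sigma> v. pfa_trans P \<sigma> *\<^sub>v v) (tape w) (unit_vec (pfa_size P) (pfa_init P))"

definition pfa_accept_prob :: "'a pfa \<Rightarrow> 'a list \<Rightarrow> real" where
  "pfa_accept_prob P w = (\<Sum>q\<in>pfa_accepting P. pfa_final_vec P w $ q)"

definition S_eq_rat :: "'a list set set" where
  "S_eq_rat =
     {L. \<exists>P :: 'a pfa. is_pfa P \<and> rational_pfa P \<and>
           (\<forall>w. pfa_accept_prob P w = 1 / 2 \<longleftrightarrow> w \<in> L)}"


datatype outcome = Nonhalting | Accept | Reject | Restart

(* The partition of the states into Q_non, Q_acc, Q_rej and Q_restart is given by the function
   qfa_class; only its values on the states 0, ..., n-1 matter. *)

record 'a qfa =
  qfa_size :: nat
  qfa_init :: nat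
  qfa_class :: "nat \<Rightarrow> outcome"
  qfa_op :: "'a tape_symbol \<Rightarrow> complex mat"

definition unitary_mat :: "nat \<Rightarrow> complex mat \<Rightarrow> bool" where
  "unitary_mat n U \<longleftrightarrow>
     U \<in> carrier_mat n n \<and> mat_adjoint U * U = 1\<^sub>m n \<and> U * mat_adjoint U = 1\<^sub>m n"

definition l2norm :: "complex vec \<Rightarrow> real" where
  "l2norm v = sqrt (\<Sum>i<dim_vec v. (cmod (v $ i))\<^sup>2)"

definition project :: "'a qfa \<Rightarrow> outcome \<Rightarrow> complex vec \<Rightarrow> complex vec" where
  "project M x v = vec (dim_vec v) (\<lambda>i. if qfa_class M i = x then v $ i else 0)"

definition normalized :: "complex vec \<Rightarrow> complex vec" where
  "normalized v = complex_of_real (1 / l2norm v) \<cdot>\<^sub>v v"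

(* Probability that one round, continued from state vector v with the given symbols still to be
   read, ends by the measurement outcome x (meant for x different from Nonhalting).  If the
   projection onto the nonhalting states is 0, its normalization is the junk value 0, but the
   recursive call is then weighted by 0. *)

fun outcome_prob_from ::
    "'a qfa \<Rightarrow> outcome \<Rightarrow> complex vec \<Rightarrow> 'a tape_symbol list \<Rightarrow> real" where
  "outcome_prob_from M x v [] = 0"
| "outcome_prob_from M x v (\<sigma> # \<tau>) =
     (let u = qfa_op M \<sigma> *\<^sub>v v; r = project M Nonhalting u
      in (l2norm (project M x u))\<^sup>2 +
         (l2norm r)\<^sup>2 * outcome_prob_from M x (normalized r) \<tau>)"

definition round_prob :: "'a qfa \<Rightarrow> outcome \<Rightarrow> 'a list \<Rightarrow> real" where
  "round_prob M x w = outcome_prob_from M x (unit_vec (qfa_size M) (qfa_init M)) (tape w)"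

definition is_restart_qfa :: "'a qfa \<Rightarrow> bool" where
  "is_restart_qfa M \<longleftrightarrow>
     qfa_init M < qfa_size M \<and>
     qfa_class M (qfa_init M) = Nonhalting \<and>
     (\<forall>\<sigma>. unitary_mat (qfa_size M) (qfa_op M \<sigma>)) \<and>
     (\<forall>w. round_prob M Accept w + round_prob M Reject w + round_prob M Restart w = 1)"

(* Probability of eventually halting with x = Accept or x = Reject: the k-th summand is the
   probability that the first k rounds restart and the next one ends with x.  For a machine
   satisfying is_restart_qfa the series always converges; when every round restarts with
   probability 1, all its terms are 0. *)

definition halt_prob :: "'a qfa \<Rightarrow> outcome \<Rightarrow> 'a list \<Rightarrow> real" where
  "halt_prob M x w = (\<Sum>k. round_prob M Restart w ^ k * round_prob M x w)"

definition recognizes_one_sided :: "'a qfa \<Rightarrow> 'a list set \<Rightarrow> real \<Rightarrow> bool" where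
  "recognizes_one_sided M K \<epsilon> \<longleftrightarrow>
     (\<forall>w\<in>K. halt_prob M Accept w = 1) \<and> (\<forall>w. w \<notin> K \<longrightarrow> halt_prob M Reject w \<ge> 1 - \<epsilon>) \<or>
     (\<forall>w. w \<notin> K \<longrightarrow> halt_prob M Reject w = 1) \<and> (\<forall>w\<in>K. halt_prob M Accept w \<ge> 1 - \<epsilon>)"

end

theory Submission
  imports Defs
begin

text \<open>If $N$ is a common denominator of the entries of the automaton, the integer
  $z = N^{\<bar>w\<bar>+2}(2p(w)-1)$ vanishes exactly when $p(w) = \frac12$ and has modulus at
  least $1$ otherwise. A round multiplies the state vector by $c$ times an integer matrix per symbol,
  the factor $c>0$ making it a contraction that is completed to a unitary operator; the excess
  amplitude goes to restart states. An extra coordinate is kept at integer value $1$, so that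
  the round ends with amplitude $c^{\<bar>w\<bar>+2}z$ in one halting state and
  $c^{\<bar>w\<bar>+2}\sqrt\epsilon$ in the other. Conditioned on halting, the probabilities are
  therefore in the ratio $z^2 : \epsilon$. Exchanging the two halting states gives the machine for
  the complement.\<close>

section \<open>Completing a small real matrix to an isometry and then to a unitary matrix\<close>

lemma sum_lessThan_add:
  fixes f :: "nat \<Rightarrow> 'b::comm_monoid_add"
  shows "(\<Sum>i<a + b. f i) = (\<Sum>i<a. f i) + (\<Sum>i<b. f (a + i))"
  by (induction b) (auto simp: add.assoc)

text \<open>Rows indexed by pairs will be stored as consecutive rows of a matrix, with
  \<open>div\<close> and \<open>mod\<close> decoding the pair; this recovers the double sum in their
  Gram matrix.\<close>

lemma sum_div_mod:
  fixes f :: "nat \<Rightarrow> nat \<Rightarrow> 'b::comm_monoid_add"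
  shows "(\<Sum>r<m * k. f (r div k) (r mod k)) = (\<Sum>i<m. \<Sum>j<k. f i j)"
proof (induction m)
  case (Suc m)
  have "(\<Sum>r<Suc m * k. f (r div k) (r mod k)) = (\<Sum>r<m * k + k. f (r div k) (r mod k))"
    by (simp add: add.commute)
  also have "\<dots> = (\<Sum>i<m. \<Sum>j<k. f i j) + (\<Sum>i<k. f ((m * k + i) div k) ((m * k + i) mod k))"
    by (simp add: sum_lessThan_add Suc)
  also have "(\<Sum>i<k. f ((m * k + i) div k) ((m * k + i) mod k)) = (\<Sum>j<k. f m j)"
    by (rule sum.cong) auto
  finally show ?case by simp
qed simp

text \<open>With $G = C^TC$, the rows $\sqrt{\<bar>G_{ij}\<bar>/2}\,(e_i - \mathrm{sgn}(G_{ij})\,e_j)$ for all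
  pairs $(i,j)$ have Gram matrix $S - G$, where $S$ is diagonal with
  $S_{aa} = \sum_b \<bar>G_{ab}\<bar> \le 1$; a diagonal block supplies the remaining $I - S$.\<close>

lemma orthonormal_columns_extension:
  fixes C :: "nat \<Rightarrow> nat \<Rightarrow> real"
  assumes small: "\<And>a. a < k \<Longrightarrow> (\<Sum>b<k. \<bar>\<Sum>i<r. C i a * C i b\<bar>) \<le> 1"
  shows "\<exists>V. (\<forall>i<r. \<forall>j. V i j = C i j) \<and>
    (\<forall>a<k. \<forall>b<k. (\<Sum>i<r + (k * k + k). V i a * V i b) = (if a = b then 1 else 0))"
proof -
  define G where "G = (\<lambda>a b. \<Sum>i<r. C i a * C i b)"
  define S where "S = (\<lambda>a. \<Sum>b<k. \<bar>G a b\<bar>)"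
  define P where "P = (\<lambda>i j a. sqrt (\<bar>G i j\<bar> / 2) *
    ((if a = i then 1 else 0) - sgn (G i j) * (if a = j then 1 else 0)) :: real)"
  define W where "W = (\<lambda>i a. if a = i then sqrt (1 - S i) else 0 :: real)"
  \<comment> \<open>Three blocks of rows: the given \<open>r\<close> rows, then \<open>k * k\<close>
    rows \<open>P\<close> for the pairs (i, j), then \<open>k\<close> diagonal rows \<open>W\<close>
    for the remaining defect.\<close>
  define V where "V = (\<lambda>i a. if i < r then C i a
    else if i < r + k * k then P ((i - r) div k) ((i - r) mod k) a
    else W (i - r - k * k) a)"
  have G_sym: "G a b = G b a" for a b
    by (simp add: G_def mult.commute)
  have G_diag: "G a a \<ge> 0" for a
    by (simp add: G_def sum_nonneg)
  have S_le: "S a \<le> 1" if "a < k" for a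
    using small[OF that] by (simp add: S_def G_def)
  have gram: "(\<Sum>i<r + (k * k + k). V i a * V i b) = (if a = b then 1 else 0)"
    if a: "a < k" and b: "b < k" for a b
  proof -
    have "(\<Sum>i<r + (k * k + k). V i a * V i b)
        = G a b + ((\<Sum>s<k * k. P (s div k) (s mod k) a * P (s div k) (s mod k) b)
          + (\<Sum>i<k. W i a * W i b))"
      unfolding sum_lessThan_add by (simp add: V_def G_def)
    also have "(\<Sum>s<k * k. P (s div k) (s mod k) a * P (s div k) (s mod k) b)
        = (\<Sum>i<k. \<Sum>j<k. P i j a * P i j b)"
      by (rule sum_div_mod)
    \<comment> \<open>Each product of two entries splits into four Kronecker-delta terms. Symmetry
      of \<open>G\<close> lets every coefficient be written in terms of \<open>a\<close> and
      \<open>b\<close>, so that the double sum collapses.\<close>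
    also have "\<dots> = (\<Sum>i<k. \<Sum>j<k.
          (if i = a then (if a = b then \<bar>G a j\<bar> / 2 else 0) else 0)
        + (if j = a then (if a = b then \<bar>G a i\<bar> / 2 else 0) else 0)
        - (if i = a then (if j = b then G a b / 2 else 0) else 0)
        - (if i = b then (if j = a then G a b / 2 else 0) else 0))"
    proof (intro sum.cong refl)
      fix i j
      define x y x' y' :: real where
        "x = (if a = i then 1 else 0)" and "y = (if a = j then 1 else 0)" and
        "x' = (if b = i then 1 else 0)" and "y' = (if b = j then 1 else 0)"
      note xy = this
      \<comment> \<open>Rests on |g| sgn g = g and |g| (sgn g)^2 = |g|, which hold for g = 0 as
        well.\<close>
      have h: "sqrt (\<bar>g\<bar> / 2) * (x - sgn g * y) * (sqrt (\<bar>g\<bar> / 2) * (x' - sgn g * y'))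
          = \<bar>g\<bar> / 2 * (x * x') + \<bar>g\<bar> / 2 * (y * y') - g / 2 * (x * y') - g / 2 * (x' * y)" for g
      proof -
        have "sqrt (\<bar>g\<bar> / 2) * (x - sgn g * y) * (sqrt (\<bar>g\<bar> / 2) * (x' - sgn g * y'))
            = (sqrt (\<bar>g\<bar> / 2) * sqrt (\<bar>g\<bar> / 2)) * ((x - sgn g * y) * (x' - sgn g * y'))"
          by (simp only: mult_ac)
        also have "sqrt (\<bar>g\<bar> / 2) * sqrt (\<bar>g\<bar> / 2) = \<bar>g\<bar> / 2"
          by simp
        also have "\<bar>g\<bar> / 2 * ((x - sgn g * y) * (x' - sgn g * y'))
            = \<bar>g\<bar> / 2 * (x * x') + \<bar>g\<bar> / 2 * (y * y') - g / 2 * (x * y') - g / 2 * (x' * y)"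
          by (cases "g = 0"; cases "g > 0") (simp_all add: algebra_simps)
        finally show ?thesis .
      qed
      have "\<bar>G i j\<bar> / 2 * (x * x') = (if i = a then (if a = b then \<bar>G a j\<bar> / 2 else 0) else 0)"
        by (simp add: xy)
      moreover have "\<bar>G i j\<bar> / 2 * (y * y') = (if j = a then (if a = b then \<bar>G a i\<bar> / 2 else 0) else 0)"
        by (simp add: xy G_sym[of i])
      moreover have "G i j / 2 * (x * y') = (if i = a then (if j = b then G a b / 2 else 0) else 0)"
        by (simp add: xy)
      moreover have "G i j / 2 * (x' * y) = (if i = b then (if j = a then G a b / 2 else 0) else 0)"
        by (simp add: xy G_sym[of i])
      moreover have "P i j a * P i j b = sqrt (\<bar>G i j\<bar> / 2) * (x - sgn (G i j) * y)
          * (sqrt (\<bar>G i j\<bar> / 2) * (x' - sgn (G i j) * y'))"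
        by (simp only: P_def xy)
      ultimately show "P i j a * P i j b =
          (if i = a then (if a = b then \<bar>G a j\<bar> / 2 else 0) else 0)
        + (if j = a then (if a = b then \<bar>G a i\<bar> / 2 else 0) else 0)
        - (if i = a then (if j = b then G a b / 2 else 0) else 0)
        - (if i = b then (if j = a then G a b / 2 else 0) else 0)"
        by (simp only: h)
    qed
    \<comment> \<open>The two diagonal terms contribute half of \<open>S a\<close> each, the two
      mixed terms half of \<open>G a b\<close> each.\<close>
    also have "\<dots> = (if a = b then S a else 0) - G a b"
    proof -
      have pull: "(\<Sum>j<k. if c then f j else 0) = (if c then \<Sum>j<k. f j else 0)" for c and f :: "nat \<Rightarrow> real"
        by simp
      show ?thesis
        using a b by (simp add: sum.distrib sum_subtractf S_def pull sum_divide_distrib[symmetric])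
    qed
    also have "(\<Sum>i<k. W i a * W i b) = (\<Sum>i<k. if i = a then (if a = b then 1 - S a else 0) else 0)"
      using S_le by (intro sum.cong) (auto simp: W_def)
    also have "\<dots> = (if a = b then 1 - S a else 0)"
      using a by simp
    finally show ?thesis by simp
  qed
  show ?thesis
    using gram by (intro exI[of _ V]) (auto simp: V_def)
qed

lemma mat_adjoint_of_real:
  "mat_adjoint (map_mat complex_of_real U) = map_mat complex_of_real U\<^sup>T"
  by (rule eq_matI) (auto simp: mat_adjoint_def mat_of_rows_index)

text \<open>An isometry $V$ is a corner of the unitary matrix
  $[V, I - VV^T; 0, V^T]$.\<close>

lemma isometry_unitary_dilation:
  fixes V :: "nat \<Rightarrow> nat \<Rightarrow> real"
  assumes orth: "\<And>a b. a < k \<Longrightarrow> b < k \<Longrightarrow> (\<Sum>i<m. V i a * V i b) = (if a = b then 1 else 0)"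
  shows "\<exists>U. unitary_mat (m + k) U \<and>
    (\<forall>i<m + k. \<forall>j<k. U $$ (i, j) = complex_of_real (if i < m then V i j else 0))"
proof -
  define A where "A = mat m k (\<lambda>(i, j). V i j)"
  have A: "A \<in> carrier_mat m k" by (simp add: A_def)
  have At: "A\<^sup>T \<in> carrier_mat k m" using A by simp
  have AtA: "A\<^sup>T * A = 1\<^sub>m k"
    by (rule eq_matI) (auto simp: A_def scalar_prod_def orth atLeast0LessThan)
  \<comment> \<open>The orthogonal projection onto the complement of the range of \<open>A\<close>.
    Its being symmetric, idempotent and annihilated by \<open>A\<close> on either side yields all
    four blocks of the product below.\<close>
  define Q where "Q = 1\<^sub>m m - A * A\<^sup>T"
  have Q: "Q \<in> carrier_mat m m" using A unfolding Q_def carrier_mat_def by simp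
  have Qt: "Q\<^sup>T = Q"
    unfolding Q_def using A At by (simp add: transpose_minus[of _ m m] transpose_mult[of _ m k _ m])
  have AtQ: "A\<^sup>T * Q = 0\<^sub>m k m"
  proof -
    have "A\<^sup>T * Q = A\<^sup>T * 1\<^sub>m m - A\<^sup>T * (A * A\<^sup>T)"
      unfolding Q_def by (rule mult_minus_distrib_mat[OF At]) (use A At in auto)
    also have "A\<^sup>T * (A * A\<^sup>T) = (A\<^sup>T * A) * A\<^sup>T"
      by (rule assoc_mult_mat[symmetric, OF At A At])
    finally show ?thesis using At by (simp add: AtA)
  qed
  have QA: "Q * A = 0\<^sub>m m k"
    using arg_cong[OF AtQ, of transpose_mat] A At Q
    by (simp add: transpose_mult[OF At Q] Qt)
  have QQ: "Q * Q = Q"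
  proof -
    have "Q * Q = Q * (1\<^sub>m m - A * A\<^sup>T)"
      by (simp add: Q_def)
    also have "\<dots> = Q * 1\<^sub>m m - Q * (A * A\<^sup>T)"
      by (rule mult_minus_distrib_mat[OF Q]) (use A At in auto)
    also have "Q * (A * A\<^sup>T) = (Q * A) * A\<^sup>T"
      by (rule assoc_mult_mat[symmetric, OF Q A At])
    also have "Q * 1\<^sub>m m - (Q * A) * A\<^sup>T = Q"
      by (rule eq_matI) (use Q At in \<open>auto simp: QA\<close>)
    finally show ?thesis .
  qed
  define R where "R = four_block_mat A Q (0\<^sub>m k k) A\<^sup>T"
  have R: "R \<in> carrier_mat (m + k) (m + k)"
    using four_block_carrier_mat[OF A At, of Q "0\<^sub>m k k"] by (simp only: R_def add.commute)
  have RT: "R\<^sup>T = four_block_mat A\<^sup>T (0\<^sub>m k k) Q A"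
    unfolding R_def using transpose_four_block_mat[OF A Q zero_carrier_mat[of k k] At] by (simp add: Qt)
  have "R\<^sup>T * R = 1\<^sub>m (m + k)"
  proof -
    have "R\<^sup>T * R = four_block_mat (A\<^sup>T * A + 0\<^sub>m k k * 0\<^sub>m k k) (A\<^sup>T * Q + 0\<^sub>m k k * A\<^sup>T)
        (Q * A + A * 0\<^sub>m k k) (Q * Q + A * A\<^sup>T)"
      unfolding RT unfolding R_def
      by (rule mult_four_block_mat[OF At zero_carrier_mat Q A A Q zero_carrier_mat At])
    also have "\<dots> = four_block_mat (1\<^sub>m k) (0\<^sub>m k m) (0\<^sub>m m k) (1\<^sub>m m)"
    proof -
      have "Q + A * A\<^sup>T = 1\<^sub>m m"
        by (rule eq_matI) (use A in \<open>auto simp: Q_def\<close>)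
      then show ?thesis
        using A At by (simp add: AtA AtQ QA QQ)
    qed
    finally show ?thesis by (simp add: add.commute)
  qed
  moreover define U where "U = map_mat complex_of_real R"
  ultimately have UU: "mat_adjoint U * U = 1\<^sub>m (m + k)"
    unfolding U_def mat_adjoint_of_real
    using R by (simp add: of_real_hom.mat_hom_mult[symmetric, of _ "m+k" "m+k" _ "m+k"] of_real_hom.mat_hom_one)
  have U: "U \<in> carrier_mat (m + k) (m + k)" using R by (simp add: U_def)
  have "mat_adjoint U \<in> carrier_mat (m + k) (m + k)"
    unfolding U_def mat_adjoint_of_real using R by simp
  then have "unitary_mat (m + k) U"
    unfolding unitary_mat_def using U UU mat_mult_left_right_inverse[OF _ U UU] by blast
  moreover have "U $$ (i, j) = complex_of_real (if i < m then V i j else 0)"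
    if "i < m + k" "j < k" for i j
    using that A Q by (auto simp: U_def R_def A_def)
  ultimately show ?thesis by blast
qed


section \<open>One round of the quantum machine as an unnormalized real linear evolution\<close>

definition apply_fun :: "nat \<Rightarrow> (nat \<Rightarrow> nat \<Rightarrow> real) \<Rightarrow> (nat \<Rightarrow> real) \<Rightarrow> nat \<Rightarrow> real" where
  "apply_fun k A y i = (\<Sum>j<k. A i j * y j)"

definition run :: "('s \<Rightarrow> nat \<Rightarrow> nat \<Rightarrow> real) \<Rightarrow> nat \<Rightarrow> 's list \<Rightarrow> (nat \<Rightarrow> real) \<Rightarrow> nat \<Rightarrow> real" where
  "run V k \<tau> y = fold (\<lambda>\<sigma>. apply_fun k (V \<sigma>)) \<tau> y"

lemma run_simps [simp]:
  "run V k [] y = y"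
  "run V k (\<sigma> # \<tau>) y = run V k \<tau> (apply_fun k (V \<sigma>) y)"
  "run V k (\<tau> @ [\<sigma>]) y = apply_fun k (V \<sigma>) (run V k \<tau> y)"
  by (simp_all add: run_def)

text \<open>The coordinates below \<open>k\<close> stand for the nonhalting states. The cut-off at
  \<open>k\<close> is the measurement: \<open>apply_fun\<close> also produces values at
  \<open>i\<close> at or above \<open>k\<close>, the amplitudes that leave the round, but never
  reads them again.\<close>

definition embed :: "nat \<Rightarrow> nat \<Rightarrow> (nat \<Rightarrow> real) \<Rightarrow> complex vec" where
  "embed n k y = vec n (\<lambda>i. complex_of_real (if i < k then y i else 0))"

lemma l2norm_sq: "(l2norm v)\<^sup>2 = (\<Sum>i<dim_vec v. (cmod (v $ i))\<^sup>2)"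
  by (simp add: l2norm_def sum_nonneg)

lemma l2norm_smult: "l2norm (complex_of_real a \<cdot>\<^sub>v v) = \<bar>a\<bar> * l2norm v"
proof -
  have "l2norm (complex_of_real a \<cdot>\<^sub>v v) = sqrt (a\<^sup>2 * (\<Sum>i<dim_vec v. (cmod (v $ i))\<^sup>2))"
    by (simp add: l2norm_def sum_distrib_left norm_mult power_mult_distrib)
  then show ?thesis
    by (simp add: real_sqrt_mult l2norm_def)
qed

lemma l2norm_eq_0: "l2norm v = 0 \<Longrightarrow> v = 0\<^sub>v (dim_vec v)"
  by (rule eq_vecI) (auto simp: l2norm_def sum_nonneg_eq_0_iff)

lemma l2norm_nonneg: "l2norm v \<ge> 0"
  by (simp add: l2norm_def sum_nonneg)

lemma normalized_smult:
  "a > 0 \<Longrightarrow> normalized (complex_of_real a \<cdot>\<^sub>v v) = normalized v"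
  by (simp add: normalized_def l2norm_smult smult_smult_assoc)

lemma project_smult: "project M x (c \<cdot>\<^sub>v v) = c \<cdot>\<^sub>v project M x v"
  by (rule eq_vecI) (auto simp: project_def)

lemma project_zero: "project M x (0\<^sub>v n) = 0\<^sub>v n"
  by (rule eq_vecI) (auto simp: project_def)

lemma outcome_prob_from_zero:
  assumes "\<And>\<sigma>. qfa_op M \<sigma> \<in> carrier_mat n n"
  shows "outcome_prob_from M x (0\<^sub>v n) \<tau> = 0"
proof (cases \<tau>)
  case (Cons \<sigma> \<tau>')
  have "qfa_op M \<sigma> *\<^sub>v 0\<^sub>v n = 0\<^sub>v n"
    using assms[of \<sigma>] by (intro eq_vecI) auto
  then show ?thesis
    by (simp add: Cons project_zero l2norm_def)
qed simp

lemma outcome_prob_from_smult: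
  assumes op: "\<And>\<sigma>. qfa_op M \<sigma> \<in> carrier_mat n n" and v: "v \<in> carrier_vec n" and a: "a > 0"
  shows "outcome_prob_from M x (complex_of_real a \<cdot>\<^sub>v v) \<tau> = a\<^sup>2 * outcome_prob_from M x v \<tau>"
proof (cases \<tau>)
  case (Cons \<sigma> \<tau>')
  show ?thesis
    using a by (simp add: Cons Let_def mult_mat_vec[OF op v] project_smult l2norm_smult
        normalized_smult power_mult_distrib distrib_left mult.assoc)
qed simp

text \<open>Rescaling the state rescales all later probabilities quadratically, so the normalization
  after each measurement can be dropped.\<close>

lemma outcome_prob_from_Cons:
  assumes op: "\<And>\<sigma>. qfa_op M \<sigma> \<in> carrier_mat n n" and v: "v \<in> carrier_vec n"
  shows "outcome_prob_from M x v (\<sigma> # \<tau>) =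
    (l2norm (project M x (qfa_op M \<sigma> *\<^sub>v v)))\<^sup>2 +
    outcome_prob_from M x (project M Nonhalting (qfa_op M \<sigma> *\<^sub>v v)) \<tau>"
proof -
  define r where "r = project M Nonhalting (qfa_op M \<sigma> *\<^sub>v v)"
  have r: "r \<in> carrier_vec n"
    using op[of \<sigma>] by (auto simp: r_def project_def)
  have "(l2norm r)\<^sup>2 * outcome_prob_from M x (normalized r) \<tau> = outcome_prob_from M x r \<tau>"
  \<comment> \<open>With zero norm, \<open>normalized r\<close> is a junk value, but its weight is 0
    and the right side vanishes because the zero vector yields no outcome.\<close>
  proof (cases "l2norm r = 0")
    case True
    then have "r = 0\<^sub>v n" using l2norm_eq_0[OF True] r by simp
    then show ?thesis using True by (simp add: outcome_prob_from_zero[OF op])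
  next
    case False
    then have pos: "1 / l2norm r > 0" using l2norm_nonneg[of r] by simp
    show ?thesis
      unfolding normalized_def using outcome_prob_from_smult[OF op r pos] False
      by (simp add: power_divide)
  qed
  then show ?thesis by (simp add: Let_def r_def)
qed

context
  fixes M :: "'a qfa" and n k :: nat and V :: "'a tape_symbol \<Rightarrow> nat \<Rightarrow> nat \<Rightarrow> real"
  assumes k_le: "k \<le> n"
    and op: "\<And>\<sigma>. qfa_op M \<sigma> \<in> carrier_mat n n"
    and entries: "\<And>\<sigma> i j. i < n \<Longrightarrow> j < k \<Longrightarrow> qfa_op M \<sigma> $$ (i, j) = complex_of_real (V \<sigma> i j)"
    and nonhalting: "\<And>i. i < n \<Longrightarrow> qfa_class M i = Nonhalting \<longleftrightarrow> i < k"
begin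

lemma op_embed: "qfa_op M \<sigma> *\<^sub>v embed n k y = vec n (\<lambda>i. complex_of_real (apply_fun k (V \<sigma>) y i))"
proof (rule eq_vecI)
  fix i assume "i < dim_vec (vec n (\<lambda>i. complex_of_real (apply_fun k (V \<sigma>) y i)))"
  then have i: "i < n" by simp
  have "(qfa_op M \<sigma> *\<^sub>v embed n k y) $ i =
      (\<Sum>j<n. qfa_op M \<sigma> $$ (i, j) * complex_of_real (if j < k then y j else 0))"
    using op[of \<sigma>] i by (auto simp: scalar_prod_def embed_def atLeast0LessThan intro!: sum.cong)
  also have "\<dots> = (\<Sum>j<k. qfa_op M \<sigma> $$ (i, j) * complex_of_real (if j < k then y j else 0))"
    using k_le by (intro sum.mono_neutral_right) auto
  also have "\<dots> = complex_of_real (apply_fun k (V \<sigma>) y i)"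
    using i by (simp add: apply_fun_def entries)
  finally show "(qfa_op M \<sigma> *\<^sub>v embed n k y) $ i
      = vec n (\<lambda>i. complex_of_real (apply_fun k (V \<sigma>) y i)) $ i"
    using i by simp
qed (use op[of \<sigma>] in auto)

text \<open>Projecting onto the nonhalting states keeps exactly the coordinates below
  \<open>k\<close>, so the state stays of the form \<open>embed\<close>, and only the first
  \<open>k\<close> columns of the operators ever matter.\<close>

lemma outcome_prob_from_embed:
  "outcome_prob_from M x (embed n k y) (\<sigma> # \<tau>) =
    (\<Sum>i<n. if qfa_class M i = x then (apply_fun k (V \<sigma>) y i)\<^sup>2 else 0) +
    outcome_prob_from M x (embed n k (apply_fun k (V \<sigma>) y)) \<tau>"
proof -
  have "project M Nonhalting (qfa_op M \<sigma> *\<^sub>v embed n k y) = embed n k (apply_fun k (V \<sigma>) y)"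
    unfolding op_embed by (rule eq_vecI) (auto simp: project_def embed_def nonhalting)
  moreover have "(l2norm (project M x (qfa_op M \<sigma> *\<^sub>v embed n k y)))\<^sup>2 =
      (\<Sum>i<n. if qfa_class M i = x then (apply_fun k (V \<sigma>) y i)\<^sup>2 else 0)"
    unfolding op_embed l2norm_sq by (auto simp: project_def intro!: sum.cong)
  ultimately show ?thesis
    by (subst outcome_prob_from_Cons[OF op]) (simp_all add: embed_def)
qed

text \<open>The class \<open>x\<close> is the single state \<open>t\<close>, and its row vanishes
  for all symbols but the last; hence only the last measurement contributes.\<close>

lemma outcome_prob_from_last:
  assumes t: "t < n" and cls: "\<And>i. i < n \<Longrightarrow> qfa_class M i = x \<longleftrightarrow> i = t"
    and zero: "\<And>\<sigma> j. \<sigma> \<in> set \<tau> \<Longrightarrow> j < k \<Longrightarrow> V \<sigma> t j = 0"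
  shows "outcome_prob_from M x (embed n k y) (\<tau> @ [\<rho>]) = (run V k (\<tau> @ [\<rho>]) y t)\<^sup>2"
proof -
  have eq: "(\<Sum>i<n. if qfa_class M i = x then (f i)\<^sup>2 else 0) = (f t)\<^sup>2" for f :: "nat \<Rightarrow> real"
  proof -
    have "(\<Sum>i<n. if qfa_class M i = x then (f i)\<^sup>2 else 0) = (\<Sum>i<n. if i = t then (f i)\<^sup>2 else 0)"
      by (intro sum.cong) (auto simp: cls)
    then show ?thesis using t by simp
  qed
  show ?thesis
    using zero
  proof (induction \<tau> arbitrary: y)
    case Nil
    show ?case by (simp add: outcome_prob_from_embed eq del: outcome_prob_from.simps(2))
  next
    case (Cons \<sigma> \<tau>)
    have "apply_fun k (V \<sigma>) y t = 0"
      using Cons.prems by (simp add: apply_fun_def)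
    then show ?case
      using Cons by (simp add: outcome_prob_from_embed eq del: outcome_prob_from.simps(2))
  qed
qed

text \<open>Conservation of squared norm: orthonormal columns preserve it at each symbol, and the
  measurement divides it among the four outcomes. The last sum is the weight still nonhalting after
  the last symbol.\<close>

lemma outcome_prob_from_total:
  assumes orth: "\<And>\<sigma> a b. a < k \<Longrightarrow> b < k \<Longrightarrow> (\<Sum>i<n. V \<sigma> i a * V \<sigma> i b) = (if a = b then 1 else 0)"
  shows "outcome_prob_from M Accept (embed n k y) \<tau> + outcome_prob_from M Reject (embed n k y) \<tau>
    + outcome_prob_from M Restart (embed n k y) \<tau> + (\<Sum>j<k. (run V k \<tau> y j)\<^sup>2) = (\<Sum>j<k. (y j)\<^sup>2)"
proof (induction \<tau> arbitrary: y)
  case (Cons \<sigma> \<tau>)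
  define z where "z = apply_fun k (V \<sigma>) y"
  have "(\<Sum>i<n. (z i)\<^sup>2) = (\<Sum>i<n. \<Sum>a<k. \<Sum>b<k. y a * y b * (V \<sigma> i a * V \<sigma> i b))"
    by (simp add: z_def apply_fun_def power2_eq_square sum_product mult_ac)
  also have "\<dots> = (\<Sum>a<k. \<Sum>b<k. \<Sum>i<n. y a * y b * (V \<sigma> i a * V \<sigma> i b))"
    by (subst sum.swap) (intro sum.cong refl sum.swap)
  also have "\<dots> = (\<Sum>a<k. \<Sum>b<k. if b = a then (y a)\<^sup>2 else 0)"
    by (intro sum.cong refl) (auto simp: sum_distrib_left[symmetric] orth power2_eq_square)
  also have "\<dots> = (\<Sum>a<k. (y a)\<^sup>2)"
    by simp
  finally have norm: "(\<Sum>i<n. (z i)\<^sup>2) = (\<Sum>a<k. (y a)\<^sup>2)" .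
  have "(\<Sum>j<k. (z j)\<^sup>2) = (\<Sum>i<n. if qfa_class M i = Nonhalting then (z i)\<^sup>2 else 0)"
    using k_le by (intro sum.mono_neutral_cong_left) (auto simp: nonhalting)
  then have "(\<Sum>i<n. if qfa_class M i = Accept then (z i)\<^sup>2 else 0)
      + (\<Sum>i<n. if qfa_class M i = Reject then (z i)\<^sup>2 else 0)
      + (\<Sum>i<n. if qfa_class M i = Restart then (z i)\<^sup>2 else 0)
      + (\<Sum>j<k. (z j)\<^sup>2) = (\<Sum>i<n. (z i)\<^sup>2)"
    unfolding sum.distrib[symmetric]
  proof (simp only: sum.distrib[symmetric], intro sum.cong refl)
    fix i
    show "(if qfa_class M i = Accept then (z i)\<^sup>2 else 0) +
        (if qfa_class M i = Reject then (z i)\<^sup>2 else 0) +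
        (if qfa_class M i = Restart then (z i)\<^sup>2 else 0) +
        (if qfa_class M i = Nonhalting then (z i)\<^sup>2 else 0) = (z i)\<^sup>2"
      by (cases "qfa_class M i") auto
  qed
  then show ?case
    using Cons.IH[of z] norm unfolding z_def
    by (simp add: outcome_prob_from_embed del: outcome_prob_from.simps(2))
qed simp

end

section \<open>From arbitrary real matrices to a restart automaton\<close>

lemma run_scaled:
  assumes "k \<le> r" and "\<And>\<sigma> i j. i < r \<Longrightarrow> V \<sigma> i j = c * D \<sigma> i j" and "i < r"
  shows "run V k \<tau> y i = c ^ length \<tau> * run D k \<tau> y i"
  using \<open>i < r\<close>
proof (induction \<tau> arbitrary: i rule: rev_induct)
  case (snoc \<sigma> \<tau>)
  have "run V k (\<tau> @ [\<sigma>]) y i = (\<Sum>j<k. c * D \<sigma> i j * (c ^ length \<tau> * run D k \<tau> y j))"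
    using snoc assms(1) by (simp add: apply_fun_def assms(2))
  then show ?case
    by (simp add: apply_fun_def sum_distrib_left mult_ac)
qed simp

lemma finite_tape_symbols: "finite (UNIV :: 'a::finite tape_symbol set)"
proof -
  have "(UNIV :: 'a tape_symbol set) = {Left_End, Right_End} \<union> range Letter"
    by (auto intro: tape_symbol.exhaust)
  then show ?thesis by (metis finite.emptyI finite.insertI finite_UnI finite_imageI finite)
qed

text \<open>Rows \<open>k\<close> and \<open>k + 1\<close> of \<open>D\<close> are the two halting
  amplitudes. The assumption \<open>bottom\<close> prevents halting before the right end-marker and
  \<open>top\<close> leaves no nonhalting amplitude after it. The factor \<open>c\<close> is common
  to all symbols and so cancels in the ratio of the halting probabilities; the size depends on
  \<open>k\<close> alone.\<close>

lemma restart_qfa_of_matrices: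
  fixes D :: "'a::finite tape_symbol \<Rightarrow> nat \<Rightarrow> nat \<Rightarrow> real"
  assumes i0: "i0 < k"
    and top: "\<And>i j. i < k \<Longrightarrow> D Right_End i j = 0"
    and bottom: "\<And>\<sigma> i j. \<sigma> \<noteq> Right_End \<Longrightarrow> k \<le> i \<Longrightarrow> D \<sigma> i j = 0"
    and outcomes: "{x0, x1} = {Accept, Reject}"
  obtains M :: "'a qfa" and c :: real where
    "is_restart_qfa M" "qfa_size M = k + 2 + (k * k + k) + k" "c > 0"
    "\<And>w. round_prob M x0 w =
      (c ^ (length w + 2) * run D k (tape w) (\<lambda>i. if i = i0 then 1 else 0) k)\<^sup>2"
    "\<And>w. round_prob M x1 w =
      (c ^ (length w + 2) * run D k (tape w) (\<lambda>i. if i = i0 then 1 else 0) (k + 1))\<^sup>2"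
proof -
  define G where "G = (\<lambda>\<sigma> a b. \<bar>\<Sum>i<k + 2. D \<sigma> i a * D \<sigma> i b\<bar>)"
  \<comment> \<open>A bound uniform over the finitely many tape symbols; the added 1 makes
    \<open>K\<close> positive and gives \<open>c \<le> 1\<close>.\<close>
  define K where "K = 1 + (\<Sum>\<sigma>\<in>UNIV. \<Sum>a<k. \<Sum>b<k. G \<sigma> a b)"
  have G_nonneg: "G \<sigma> a b \<ge> 0" for \<sigma> a b by (simp add: G_def)
  have K: "(\<Sum>b<k. G \<sigma> a b) \<le> K" if "a < k" for \<sigma> a
  proof -
    have "(\<Sum>b<k. G \<sigma> a b) \<le> (\<Sum>a<k. \<Sum>b<k. G \<sigma> a b)"
      using that by (intro member_le_sum) (auto simp: G_nonneg sum_nonneg)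
    also have "\<dots> \<le> (\<Sum>\<sigma>\<in>UNIV. \<Sum>a<k. \<Sum>b<k. G \<sigma> a b)"
      by (rule member_le_sum[of \<sigma> UNIV "\<lambda>\<sigma>. \<Sum>a<k. \<Sum>b<k. G \<sigma> a b"])
        (auto simp: G_nonneg sum_nonneg finite_tape_symbols)
    finally show ?thesis by (simp add: K_def)
  qed
  have K1: "K \<ge> 1" by (simp add: K_def sum_nonneg G_nonneg)
  define c where "c = 1 / K"
  have c: "c > 0" "c \<le> 1" using K1 by (simp_all add: c_def)
  define m where "m = k + 2 + (k * k + k)"
  have "\<exists>V. (\<forall>i<k + 2. \<forall>j. V i j = c * D \<sigma> i j) \<and>
      (\<forall>a<k. \<forall>b<k. (\<Sum>i<m. V i a * V i b) = (if a = b then 1 else 0))" for \<sigma>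
    unfolding m_def
  proof (rule orthonormal_columns_extension)
    fix a assume "a < k"
    have "(\<Sum>b<k. \<bar>\<Sum>i<k + 2. c * D \<sigma> i a * (c * D \<sigma> i b)\<bar>) = (\<Sum>b<k. c * c * G \<sigma> a b)"
    proof (intro sum.cong refl)
      fix b
      have "(\<Sum>i<k + 2. c * D \<sigma> i a * (c * D \<sigma> i b)) = c * c * (\<Sum>i<k + 2. D \<sigma> i a * D \<sigma> i b)"
        unfolding sum_distrib_left by (intro sum.cong) simp_all
      then show "\<bar>\<Sum>i<k + 2. c * D \<sigma> i a * (c * D \<sigma> i b)\<bar> = c * c * G \<sigma> a b"
        using c by (simp add: G_def abs_mult)
    qed
    \<comment> \<open>One factor \<open>c\<close> cancels the bound \<open>K\<close>; the other is
      merely at most 1.\<close>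
    also have "\<dots> = c * (c * (\<Sum>b<k. G \<sigma> a b))"
      by (simp add: sum_distrib_left mult.assoc)
    also have "c * (\<Sum>b<k. G \<sigma> a b) \<le> c * K"
      using K[OF \<open>a < k\<close>] c by (intro mult_left_mono) auto
    also have "c * K = 1" using K1 by (simp add: c_def)
    finally show "(\<Sum>b<k. \<bar>\<Sum>i<k + 2. c * D \<sigma> i a * (c * D \<sigma> i b)\<bar>) \<le> 1"
      using c by simp
  qed
  then obtain V where V: "\<And>\<sigma> i j. i < k + 2 \<Longrightarrow> V \<sigma> i j = c * D \<sigma> i j"
    and orth: "\<And>\<sigma> a b. a < k \<Longrightarrow> b < k \<Longrightarrow> (\<Sum>i<m. V \<sigma> i a * V \<sigma> i b) = (if a = b then 1 else 0)"
    by metis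
  have "\<forall>\<sigma>. \<exists>U. unitary_mat (m + k) U \<and>
      (\<forall>i<m + k. \<forall>j<k. U $$ (i, j) = complex_of_real (if i < m then V \<sigma> i j else 0))"
    using isometry_unitary_dilation[OF orth] by blast
  then obtain U where U: "\<And>\<sigma>. unitary_mat (m + k) (U \<sigma>)"
    and U_entries: "\<And>\<sigma> i j. i < m + k \<Longrightarrow> j < k \<Longrightarrow>
      U \<sigma> $$ (i, j) = complex_of_real (if i < m then V \<sigma> i j else 0)"
    by metis
  \<comment> \<open>The full first \<open>k\<close> columns of the unitaries: the dilation appends
    \<open>k\<close> rows that are zero there, so orthonormality persists.\<close>
  define W where "W = (\<lambda>\<sigma> i j. if i < m then V \<sigma> i j else 0)"
  have W: "W \<sigma> i j = c * D \<sigma> i j" if "i < k + 2" for \<sigma> i j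
    using that by (simp add: W_def V m_def)
  have W_orth: "(\<Sum>i<m + k. W \<sigma> i a * W \<sigma> i b) = (if a = b then 1 else 0)" if "a < k" "b < k" for \<sigma> a b
    using orth[OF that] by (simp add: sum_lessThan_add W_def)
  \<comment> \<open>All rows added by the two completions become restart states, so they affect
    neither halting amplitude.\<close>
  define M :: "'a qfa" where "M = \<lparr>qfa_size = m + k, qfa_init = i0,
    qfa_class = (\<lambda>i. if i < k then Nonhalting else if i = k then x0 else if i = k + 1 then x1 else Restart),
    qfa_op = U\<rparr>"
  define y0 :: "nat \<Rightarrow> real" where "y0 = (\<lambda>i. if i = i0 then 1 else 0)"
  have x: "x0 \<in> {Accept, Reject}" "x1 \<in> {Accept, Reject}" "x0 \<noteq> x1"
    using outcomes by (auto simp: doubleton_eq_iff)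
  have le: "k \<le> m + k" by simp
  have op: "qfa_op M \<sigma> \<in> carrier_mat (m + k) (m + k)" for \<sigma>
    using U[of \<sigma>] by (simp add: M_def unitary_mat_def)
  have entries: "qfa_op M \<sigma> $$ (i, j) = complex_of_real (W \<sigma> i j)" if "i < m + k" "j < k" for \<sigma> i j
    using that by (simp add: M_def U_entries W_def)
  have nonhalting: "qfa_class M i = Nonhalting \<longleftrightarrow> i < k" for i
    using x by (auto simp: M_def)
  have start: "unit_vec (qfa_size M) (qfa_init M) = embed (m + k) k y0"
    using i0 by (intro eq_vecI) (auto simp: M_def embed_def y0_def)
  have tape_eq: "tape w = (Left_End # map Letter w) @ [Right_End]" for w :: "'a list"
    by (simp add: tape_def)
  have round: "round_prob M x w = (c ^ (length w + 2) * run D k (tape w) y0 t)\<^sup>2"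
    if t: "t = k \<or> t = k + 1" and cls: "\<And>i. qfa_class M i = x \<longleftrightarrow> i = t" for x t w
  proof -
    have "round_prob M x w = (run W k ((Left_End # map Letter w) @ [Right_End]) y0 t)\<^sup>2"
      unfolding round_prob_def start unfolding tape_eq
      by (rule outcome_prob_from_last[OF le op entries nonhalting _ cls])
        (use t in \<open>auto simp: m_def W bottom\<close>)
    also have "run W k ((Left_End # map Letter w) @ [Right_End]) y0 t
        = c ^ length ((Left_End # map Letter w) @ [Right_End]) * run D k ((Left_End # map Letter w) @ [Right_End]) y0 t"
      by (rule run_scaled[of k "k + 2"]) (use t W in auto)
    finally show ?thesis by (simp add: tape_def)
  qed
  have "round_prob M Accept w + round_prob M Reject w + round_prob M Restart w = 1" for w
  proof -
    have "round_prob M Accept w + round_prob M Reject w + round_prob M Restart w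
        + (\<Sum>j<k. (run W k (tape w) y0 j)\<^sup>2) = (\<Sum>j<k. (y0 j)\<^sup>2)"
      unfolding round_prob_def start
      by (rule outcome_prob_from_total[OF le op entries nonhalting W_orth])
    moreover have "run W k (tape w) y0 j = 0" if "j < k" for j
      using that unfolding tape_eq run_simps(3) by (simp add: apply_fun_def W top)
    moreover have "(\<Sum>j<k. (y0 j)\<^sup>2) = 1"
      using i0 by (simp add: y0_def if_distrib[of "\<lambda>x. x\<^sup>2"] cong: if_cong)
    ultimately show ?thesis by simp
  qed
  then have "is_restart_qfa M"
    using i0 U by (simp add: is_restart_qfa_def M_def)
  moreover have "qfa_size M = k + 2 + (k * k + k) + k"
    by (simp add: M_def m_def)
  moreover have "round_prob M x0 w = (c ^ (length w + 2) * run D k (tape w) y0 k)\<^sup>2" for w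
    by (rule round) (use x in \<open>auto simp: M_def\<close>)
  moreover have "round_prob M x1 w = (c ^ (length w + 2) * run D k (tape w) y0 (k + 1))\<^sup>2" for w
    by (rule round) (use x in \<open>auto simp: M_def\<close>)
  ultimately show ?thesis using that c(1) unfolding y0_def by blast
qed

section \<open>From the probabilities of one round to those of eventual halting\<close>

lemma outcome_prob_from_nonneg: "outcome_prob_from M x v \<tau> \<ge> 0"
  by (induction \<tau> arbitrary: v) (simp_all add: Let_def)

text \<open>A geometric series in the restart probability; the strict bound excludes the case in
  which no round ever halts.\<close>

lemma halt_prob_eq:
  assumes "round_prob M Accept w + round_prob M Reject w + round_prob M Restart w = 1"
    and "round_prob M Restart w < 1"
  shows "halt_prob M x w = round_prob M x w / (round_prob M Accept w + round_prob M Reject w)"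
proof -
  have "round_prob M Restart w \<ge> 0"
    by (simp add: round_prob_def outcome_prob_from_nonneg)
  then have "(\<lambda>k. round_prob M Restart w ^ k * round_prob M x w) sums
      (1 / (1 - round_prob M Restart w) * round_prob M x w)"
    using assms by (intro sums_mult2 geometric_sums) simp
  moreover have "1 - round_prob M Restart w = round_prob M Accept w + round_prob M Reject w"
    using assms(1) by linarith
  ultimately show ?thesis
    by (simp add: halt_prob_def sums_iff)
qed

section \<open>Integer scaling of a rational probabilistic automaton\<close>

lemma common_denominator:
  fixes S :: "real set"
  assumes "finite S" "S \<subseteq> \<rat>"
  shows "\<exists>N::nat. N > 0 \<and> (\<forall>x\<in>S. real N * x \<in> \<int>)"
  using assms
proof (induction S)
  case empty
  show ?case by (intro exI[of _ 1]) simp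
next
  case (insert a S)
  then obtain N :: nat where N: "N > 0" "\<And>x. x \<in> S \<Longrightarrow> real N * x \<in> \<int>"
    by auto
  from insert.prems obtain p q where q: "q \<noteq> 0" and a: "\<bar>a\<bar> = real p / real q"
    using Rats_abs_nat_div_natE[of a] by (metis insert_subset)
  \<comment> \<open>The fraction was obtained for the absolute value of \<open>a\<close>, so the
    sign has to be restored.\<close>
  have qa: "real q * a \<in> \<int>"
  proof -
    have "\<bar>real q * a\<bar> = real p" using q a by (simp add: abs_mult)
    then have "real q * a = real p \<or> real q * a = - real p" by linarith
    then show ?thesis by auto
  qed
  have "real (N * q) * x \<in> \<int>" if "x \<in> insert a S" for x
  proof (cases "x = a")
    case True
    have "real N * (real q * a) \<in> \<int>" by (rule Ints_mult[OF Ints_of_nat qa])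
    then show ?thesis using True by (simp add: mult.assoc)
  next
    case False
    then have "real N * x \<in> \<int>" using N(2) that by blast
    then have "real q * (real N * x) \<in> \<int>" by (rule Ints_mult[OF Ints_of_nat])
    then show ?thesis by (simp add: mult_ac)
  qed
  then show ?case using N(1) q by (intro exI[of _ "N * q"]) auto
qed

text \<open>Coordinate \<open>n\<close> is the constant \<open>1\<close>, created by the left end-marker. The two further rows are
  the halting amplitudes; the first one uses that the final distribution sums to \<open>1\<close>, so that
  accepting minus nonaccepting weight is $2p - 1$.\<close>

definition scaled_pfa_mat ::
    "'a pfa \<Rightarrow> real \<Rightarrow> real \<Rightarrow> 'a tape_symbol \<Rightarrow> nat \<Rightarrow> nat \<Rightarrow> real" where
  "scaled_pfa_mat P N \<delta> \<sigma> i j = (let n = pfa_size P in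
     if \<sigma> = Right_End then
       (if i = Suc n \<and> j < n then \<Sum>q<n. (if q \<in> pfa_accepting P then 1 else -1) * (N * pfa_trans P \<sigma> $$ (q, j))
        else if i = Suc (Suc n) \<and> j = n then \<delta> else 0)
     else if i < n \<and> j < n then N * pfa_trans P \<sigma> $$ (i, j)
     else if i = n \<and> (j = n \<or> \<sigma> = Left_End) then 1 else 0)"

context
  fixes P :: "'a pfa"
  assumes pfa: "is_pfa P"
begin

lemma pfa_trans_carrier: "pfa_trans P \<sigma> \<in> carrier_mat (pfa_size P) (pfa_size P)"
  using pfa by (simp add: is_pfa_def stochastic_mat_def)

lemma pfa_fold_carrier:
  "v \<in> carrier_vec (pfa_size P) \<Longrightarrow>
    fold (\<lambda>\<sigma> v. pfa_trans P \<sigma> *\<^sub>v v) \<tau> v \<in> carrier_vec (pfa_size P)"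
  using pfa_trans_carrier by (induction \<tau> arbitrary: v) (auto intro: mult_mat_vec_carrier)

lemma pfa_trans_mult:
  assumes "v \<in> carrier_vec (pfa_size P)" "i < pfa_size P"
  shows "(pfa_trans P \<sigma> *\<^sub>v v) $ i = (\<Sum>j<pfa_size P. pfa_trans P \<sigma> $$ (i, j) * v $ j)"
  using assms pfa_trans_carrier[of \<sigma>] by (auto simp: scalar_prod_def atLeast0LessThan)

text \<open>Columns summing to 1 preserve the total weight. This is what turns the difference of
  accepting and nonaccepting weight into 2p - 1.\<close>

lemma pfa_fold_sum:
  assumes "v \<in> carrier_vec (pfa_size P)"
  shows "(\<Sum>i<pfa_size P. fold (\<lambda>\<sigma> v. pfa_trans P \<sigma> *\<^sub>v v) \<tau> v $ i) = (\<Sum>i<pfa_size P. v $ i)"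
  using assms
proof (induction \<tau> arbitrary: v)
  case (Cons \<sigma> \<tau>)
  have "(\<Sum>i<pfa_size P. (pfa_trans P \<sigma> *\<^sub>v v) $ i)
      = (\<Sum>i<pfa_size P. \<Sum>j<pfa_size P. pfa_trans P \<sigma> $$ (i, j) * v $ j)"
    using Cons.prems by (simp add: pfa_trans_mult)
  also have "\<dots> = (\<Sum>j<pfa_size P. (\<Sum>i<pfa_size P. pfa_trans P \<sigma> $$ (i, j)) * v $ j)"
    by (subst sum.swap) (simp add: sum_distrib_right)
  also have "\<dots> = (\<Sum>j<pfa_size P. v $ j)"
    using pfa by (simp add: is_pfa_def stochastic_mat_def)
  finally show ?case
    using Cons.IH[of "pfa_trans P \<sigma> *\<^sub>v v"] mult_mat_vec_carrier[OF pfa_trans_carrier Cons.prems]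
    by simp
qed simp

text \<open>Every symbol, the left end-marker included, contributes one factor \<open>N\<close>,
  hence the exponent \<open>Suc (length u)\<close>. Integrality is carried along separately, since
  it comes from the integer entries. Coordinate \<open>pfa_size P\<close> stays unscaled at 1, which
  later makes the comparison amplitude independent of the input.\<close>

lemma scaled_run_prefix:
  fixes N \<delta> :: real
  assumes int: "\<And>\<sigma> i j. i < pfa_size P \<Longrightarrow> j < pfa_size P \<Longrightarrow> N * pfa_trans P \<sigma> $$ (i, j) \<in> \<int>"
  defines "y0 \<equiv> \<lambda>i. if i = pfa_init P then 1 else 0"
  defines "y \<equiv> \<lambda>u. run (scaled_pfa_mat P N \<delta>) (Suc (pfa_size P)) (Left_End # map Letter u) y0"
  defines "v \<equiv> \<lambda>u. fold (\<lambda>\<sigma> v. pfa_trans P \<sigma> *\<^sub>v v) (Left_End # map Letter u)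
    (unit_vec (pfa_size P) (pfa_init P))"
  shows "y u (pfa_size P) = 1 \<and> (\<forall>i<pfa_size P. y u i \<in> \<int> \<and> y u i = N ^ Suc (length u) * v u $ i)"
proof (induction u rule: rev_induct)
  case Nil
  have init: "pfa_init P < pfa_size P" using pfa by (simp add: is_pfa_def)
  have "apply_fun (Suc (pfa_size P)) (scaled_pfa_mat P N \<delta> Left_End) y0 i
      = scaled_pfa_mat P N \<delta> Left_End i (pfa_init P)" for i
    using init by (simp add: apply_fun_def y0_def if_distrib[of "(*) _"] cong: if_cong)
  moreover have "(pfa_trans P Left_End *\<^sub>v unit_vec (pfa_size P) (pfa_init P)) $ i
      = pfa_trans P Left_End $$ (i, pfa_init P)" if "i < pfa_size P" for i
    using init pfa_trans_carrier[of Left_End] that by simp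
  ultimately show ?case
    using init int by (simp add: y_def v_def scaled_pfa_mat_def)
next
  case (snoc a u)
  have yS: "y (u @ [a]) i = (\<Sum>j<Suc (pfa_size P). scaled_pfa_mat P N \<delta> (Letter a) i j * y u j)" for i
    unfolding y_def by (simp add: apply_fun_def run_def)
  have v: "v u \<in> carrier_vec (pfa_size P)"
    unfolding v_def by (rule pfa_fold_carrier) simp
  have vS: "v (u @ [a]) $ i = (\<Sum>j<pfa_size P. pfa_trans P (Letter a) $$ (i, j) * v u $ j)"
    if "i < pfa_size P" for i
    using pfa_trans_mult[OF v that] by (simp add: v_def)
  have top: "y (u @ [a]) i = (\<Sum>j<pfa_size P. (N * pfa_trans P (Letter a) $$ (i, j)) * y u j)"
    if "i < pfa_size P" for i
    unfolding yS using that by (simp add: scaled_pfa_mat_def)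
  have "y (u @ [a]) (pfa_size P) = 1"
    unfolding yS using snoc by (simp add: scaled_pfa_mat_def)
  moreover have "y (u @ [a]) i \<in> \<int>" if "i < pfa_size P" for i
    unfolding top[OF that] using snoc that by (intro Ints_sum Ints_mult[OF int]) auto
  moreover have "y (u @ [a]) i = N ^ Suc (length (u @ [a])) * v (u @ [a]) $ i" if "i < pfa_size P" for i
    unfolding top[OF that] vS[OF that] using snoc
    by (simp add: sum_distrib_left mult_ac)
  ultimately show ?case by blast
qed

lemma scaled_run_tape:
  fixes N \<delta> :: real and w :: "'a list"
  assumes int: "\<And>\<sigma> i j. i < pfa_size P \<Longrightarrow> j < pfa_size P \<Longrightarrow> N * pfa_trans P \<sigma> $$ (i, j) \<in> \<int>"
  defines "z \<equiv> run (scaled_pfa_mat P N \<delta>) (Suc (pfa_size P)) (tape w)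
    (\<lambda>i. if i = pfa_init P then 1 else 0)"
  shows "z (Suc (pfa_size P)) \<in> \<int>"
    and "z (Suc (pfa_size P)) = N ^ (length w + 2) * (2 * pfa_accept_prob P w - 1)"
    and "z (Suc (Suc (pfa_size P))) = \<delta>"
proof -
  define n where "n = pfa_size P"
  define F where "F = pfa_accepting P"
  define y where "y = run (scaled_pfa_mat P N \<delta>) (Suc n) (Left_End # map Letter w)
    (\<lambda>i. if i = pfa_init P then 1 else 0)"
  define v where "v = fold (\<lambda>\<sigma> v. pfa_trans P \<sigma> *\<^sub>v v) (Left_End # map Letter w)
    (unit_vec n (pfa_init P))"
  have y: "y n = 1" "\<And>i. i < n \<Longrightarrow> y i \<in> \<int>" "\<And>i. i < n \<Longrightarrow> y i = N ^ Suc (length w) * v $ i"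
    using scaled_run_prefix[OF int, of \<delta> w] unfolding y_def v_def n_def by blast+
  have z: "z i = (\<Sum>j<Suc n. scaled_pfa_mat P N \<delta> Right_End i j * y j)" for i
    unfolding z_def y_def tape_def n_def by (simp add: run_def apply_fun_def)
  have v: "v \<in> carrier_vec n"
    unfolding v_def n_def by (rule pfa_fold_carrier) simp
  define f where "f = pfa_final_vec P w"
  have f: "f = pfa_trans P Right_End *\<^sub>v v"
    by (simp add: f_def pfa_final_vec_def tape_def v_def n_def)
  have f_sum: "(\<Sum>q<n. f $ q) = 1"
  proof -
    have "(\<Sum>q<n. f $ q) = (\<Sum>q<n. unit_vec n (pfa_init P) $ q)"
      unfolding f_def pfa_final_vec_def n_def by (rule pfa_fold_sum) simp
    also have "\<dots> = 1"
      using pfa by (simp add: is_pfa_def n_def unit_vec_def)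
    finally show ?thesis .
  qed
  have F: "F \<subseteq> {..<n}" using pfa by (simp add: is_pfa_def F_def n_def)
  show "z (Suc (Suc (pfa_size P))) = \<delta>"
    unfolding z using y(1) by (simp add: scaled_pfa_mat_def n_def)
  have acc: "z (Suc n) = (\<Sum>j<n. (\<Sum>q<n. (if q \<in> F then 1 else -1) * (N * pfa_trans P Right_End $$ (q, j))) * y j)"
    unfolding z by (simp add: scaled_pfa_mat_def n_def F_def)
  show "z (Suc (pfa_size P)) \<in> \<int>"
    unfolding n_def[symmetric] acc
    by (intro Ints_sum Ints_mult int y(2)) (auto simp: n_def)
  have "z (Suc n) = (\<Sum>q<n. \<Sum>j<n. (if q \<in> F then 1 else -1) * (N * pfa_trans P Right_End $$ (q, j)) * y j)"
    unfolding acc sum_distrib_right by (rule sum.swap)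
  also have "\<dots> = (\<Sum>q<n. N ^ (length w + 2) * ((if q \<in> F then 1 else -1) * f $ q))"
  proof (intro sum.cong refl)
    fix q assume "q \<in> {..<n}"
    then have "f $ q = (\<Sum>j<n. pfa_trans P Right_End $$ (q, j) * v $ j)"
      unfolding f n_def by (intro pfa_trans_mult) (use v in \<open>auto simp: n_def\<close>)
    then show "(\<Sum>j<n. (if q \<in> F then 1 else -1) * (N * pfa_trans P Right_End $$ (q, j)) * y j)
        = N ^ (length w + 2) * ((if q \<in> F then 1 else -1) * f $ q)"
      by (simp add: y(3) sum_distrib_left mult_ac)
  qed
  \<comment> \<open>The sign attached to a state is twice the indicator of \<open>F\<close> minus
    1.\<close>
  also have "\<dots> = N ^ (length w + 2) * (\<Sum>q<n. 2 * (if q \<in> F then f $ q else 0) - f $ q)"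
    unfolding sum_distrib_left by (intro sum.cong refl) (simp add: algebra_simps)
  also have "(\<Sum>q<n. 2 * (if q \<in> F then f $ q else 0) - f $ q) = 2 * (\<Sum>q<n. if q \<in> F then f $ q else 0) - 1"
    by (simp add: sum_subtractf f_sum sum_distrib_left)
  also have "(\<Sum>q<n. if q \<in> F then f $ q else 0) = pfa_accept_prob P w"
    unfolding pfa_accept_prob_def F_def[symmetric] f_def[symmetric]
    using F by (intro sum.mono_neutral_cong_right) auto
  finally show "z (Suc (pfa_size P)) = N ^ (length w + 2) * (2 * pfa_accept_prob P w - 1)"
    by (simp add: n_def)
qed

end

section \<open>The machines for the language and its complement\<close>

lemma pfa_equality_restart_qfa:
  fixes P :: "'a::finite pfa"
  assumes pfa: "is_pfa P" and rat: "rational_pfa P" and \<epsilon>: "\<epsilon> > 0"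
    and outcomes: "{x0, x1} = {Accept, Reject}"
  shows "\<exists>M :: 'a qfa. is_restart_qfa M \<and>
    qfa_size M = (let k = Suc (pfa_size P) in k + 2 + (k * k + k) + k) \<and>
    (\<forall>w. if pfa_accept_prob P w = 1 / 2 then halt_prob M x1 w = 1 else halt_prob M x0 w \<ge> 1 - \<epsilon>)"
proof -
  define n where "n = pfa_size P"
  \<comment> \<open>Only finitely many entries occur because the alphabet is finite. The common
    denominator \<open>N\<close> depends on \<open>P\<close> alone; the error bound enters only
    through the matrix entry \<open>\<delta>\<close>.\<close>
  define S where "S = (\<lambda>(\<sigma>, i, j). pfa_trans P \<sigma> $$ (i, j)) ` (UNIV \<times> {..<n} \<times> {..<n})"
  have "finite S" "S \<subseteq> \<rat>"
    using rat by (auto simp: S_def finite_tape_symbols rational_pfa_def n_def)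
  then obtain N :: nat where N: "N > 0" "\<forall>x\<in>S. real N * x \<in> \<int>"
    using common_denominator by blast
  have int: "real N * pfa_trans P \<sigma> $$ (i, j) \<in> \<int>" if "i < pfa_size P" "j < pfa_size P" for \<sigma> i j
    using N(2) that by (auto simp: S_def n_def)
  define \<delta> where "\<delta> = sqrt \<epsilon>"
  have \<delta>: "\<delta>\<^sup>2 = \<epsilon>" using \<epsilon> by (simp add: \<delta>_def)
  define z where "z = (\<lambda>w. run (scaled_pfa_mat P N \<delta>) (Suc n) (tape w)
    (\<lambda>i. if i = pfa_init P then 1 else 0))"
  obtain M :: "'a qfa" and c :: real where M: "is_restart_qfa M"
      "qfa_size M = Suc n + 2 + (Suc n * Suc n + Suc n) + Suc n" "c > 0"
      "\<And>w. round_prob M x0 w = (c ^ (length w + 2) * z w (Suc n))\<^sup>2"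
      "\<And>w. round_prob M x1 w = (c ^ (length w + 2) * z w (Suc n + 1))\<^sup>2"
    unfolding z_def
  proof (rule restart_qfa_of_matrices[of "pfa_init P" "Suc n" "scaled_pfa_mat P N \<delta>" x0 x1])
    show "pfa_init P < Suc n" using pfa by (simp add: is_pfa_def n_def)
    show "{x0, x1} = {Accept, Reject}" by (rule outcomes)
  qed (auto simp: scaled_pfa_mat_def n_def)
  have z_int: "z w (Suc n) \<in> \<int>"
    and z_acc: "z w (Suc n) = real N ^ (length w + 2) * (2 * pfa_accept_prob P w - 1)"
    and z_rej: "z w (Suc n + 1) = \<delta>" for w
    using scaled_run_tape[OF pfa int, of \<delta> w] unfolding z_def n_def by simp_all
  have main: "if pfa_accept_prob P w = 1 / 2 then halt_prob M x1 w = 1 else halt_prob M x0 w \<ge> 1 - \<epsilon>" for w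
  proof -
    define C where "C = (c ^ (length w + 2))\<^sup>2"
    have C: "C > 0" using M(3) by (simp add: C_def)
    define t where "t = (z w (Suc n))\<^sup>2"
    have p: "round_prob M x0 w = C * t" "round_prob M x1 w = C * \<epsilon>"
      using M(4,5) by (simp_all add: z_rej[simplified] C_def t_def power_mult_distrib \<delta>)
    have t: "t \<ge> 0" by (simp add: t_def)
    have total: "round_prob M Accept w + round_prob M Reject w = C * (t + \<epsilon>)"
      using outcomes p by (auto simp: doubleton_eq_iff algebra_simps)
    have one: "round_prob M Accept w + round_prob M Reject w + round_prob M Restart w = 1"
      using M(1) by (simp add: is_restart_qfa_def)
    have halt: "halt_prob M x w = round_prob M x w / (C * (t + \<epsilon>))" for x
    proof -
      have "C * (t + \<epsilon>) > 0" using C t \<epsilon> by simp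
      then have "round_prob M Restart w < 1" using one total by linarith
      then show ?thesis using halt_prob_eq[OF one] total by simp
    qed
    show ?thesis
    proof (cases "pfa_accept_prob P w = 1 / 2")
      case True
      then have "t = 0" by (simp add: t_def z_acc)
      then show ?thesis using True C \<epsilon> by (simp add: halt p)
    next
      case False
      then have "z w (Suc n) \<noteq> 0" using N(1) by (simp add: z_acc)
      then have "\<bar>z w (Suc n)\<bar> \<ge> 1" by (rule Ints_nonzero_abs_ge1[OF z_int])
      then have "t \<ge> 1"
        using power_mono[of 1 "\<bar>z w (Suc n)\<bar>" 2] by (simp add: t_def)
      \<comment> \<open>Integrality pays off here: t \<ge> 1 makes the estimate hold for every
        positive \<epsilon>, however large.\<close>
      then have "(1 - \<epsilon>) * (t + \<epsilon>) \<le> t"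
      proof -
        have "(1 - \<epsilon>) * (t + \<epsilon>) = t - \<epsilon> * (t - 1) - \<epsilon> * \<epsilon>" by (simp add: algebra_simps)
        moreover have "\<epsilon> * (t - 1) \<ge> 0" using \<epsilon> \<open>t \<ge> 1\<close> by simp
        moreover have "\<epsilon> * \<epsilon> \<ge> 0" by simp
        ultimately show ?thesis by linarith
      qed
      then have "1 - \<epsilon> \<le> t / (t + \<epsilon>)"
        using t \<epsilon> by (simp add: pos_le_divide_eq)
      also have "\<dots> = halt_prob M x0 w" using C by (simp add: halt p)
      finally show ?thesis using False by simp
    qed
  qed
  then show ?thesis using M(1,2) by (intro exI[of _ M]) (simp add: n_def Let_def)
qed

theorem theorem12:
  fixes L :: "('a::finite) list set"
  assumes "L \<in> S_eq_rat"
  shows "\<exists>n. \<forall>\<epsilon>>0.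
    (\<exists>M :: 'a qfa. is_restart_qfa M \<and> qfa_size M = n \<and> recognizes_one_sided M L \<epsilon>) \<and>
    (\<exists>M :: 'a qfa. is_restart_qfa M \<and> qfa_size M = n \<and> recognizes_one_sided M (- L) \<epsilon>)"
proof -
  from assms obtain P :: "'a pfa" where P: "is_pfa P" "rational_pfa P"
    and L: "\<And>w. pfa_accept_prob P w = 1 / 2 \<longleftrightarrow> w \<in> L"
    by (auto simp: S_eq_rat_def)
  \<comment> \<open>Fixed before \<epsilon> is chosen and common to both machines.\<close>
  define n where "n = (let k = Suc (pfa_size P) in k + 2 + (k * k + k) + k)"
  have "\<exists>M :: 'a qfa. is_restart_qfa M \<and> qfa_size M = n \<and> recognizes_one_sided M L \<epsilon>" if eps: "\<epsilon> > 0" for \<epsilon>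
  proof -
    obtain M :: "'a qfa" where M: "is_restart_qfa M" "qfa_size M = n"
      and halt: "\<And>w. if pfa_accept_prob P w = 1 / 2 then halt_prob M Accept w = 1 else halt_prob M Reject w \<ge> 1 - \<epsilon>"
      using pfa_equality_restart_qfa[OF P eps, of Reject Accept] unfolding n_def by blast
    have "halt_prob M Accept w = 1" if "w \<in> L" for w
      using halt[of w] L[of w] that by simp
    moreover have "halt_prob M Reject w \<ge> 1 - \<epsilon>" if "w \<notin> L" for w
      using halt[of w] L[of w] that by simp
    ultimately show ?thesis
      using M unfolding recognizes_one_sided_def by blast
  qed
  moreover have "\<exists>M :: 'a qfa. is_restart_qfa M \<and> qfa_size M = n \<and> recognizes_one_sided M (- L) \<epsilon>"
    if eps: "\<epsilon> > 0" for \<epsilon>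
  proof -
    obtain M :: "'a qfa" where M: "is_restart_qfa M" "qfa_size M = n"
      and halt: "\<And>w. if pfa_accept_prob P w = 1 / 2 then halt_prob M Reject w = 1 else halt_prob M Accept w \<ge> 1 - \<epsilon>"
      \<comment> \<open>With the outcomes exchanged, the certain answer is rejection on
        \<open>L\<close>, so the complement is recognized in the second sense of one-sided error,
        whereas the machine for \<open>L\<close> uses the first.\<close>
      using pfa_equality_restart_qfa[OF P eps, of Accept Reject] unfolding n_def by blast
    have "halt_prob M Reject w = 1" if "w \<notin> - L" for w
      using halt[of w] L[of w] that by simp
    moreover have "halt_prob M Accept w \<ge> 1 - \<epsilon>" if "w \<in> - L" for w
      using halt[of w] L[of w] that by simp
    ultimately show ?thesis
      using M unfolding recognizes_one_sided_def by blast
  qed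
  ultimately show ?thesis by blast
qed

end
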